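(* Let $\mathbf B\in\mathbb C^{M\times M}$ be a Hermitian (possibly indefinite) matrix, and consider the generalized downlink beamforming (GDB) problem and its Lagrangian dual given in the context. Suppose that the GDB problem is bounded and that Slater's condition holds for the dual problem, i.e., there exists $\hat\beta\in\mathcal F$ such that $$\mathbf C(\hat\beta)\succ\frac{\hat\beta_k(\gamma_k+1)}{\gamma_k}\mathbf h_k\mathbf h_k^{H}\qquad\text{for all }k=1,\dots,K.$$ Let $\hat{\mathcal S}=\{\beta\in\mathbb R^K:\beta\ge\hat\beta\}$. Then the fixed point iteration $\beta^{(i+1)}=I(\beta^{(i)})$ converges to the optimal dual solution $\beta^\star$ for any initialization $\beta^{(0)}\in\hat{\mathcal S}$. Moreover, $\beta^\star$ is the unique fixed point of $I(\cdot)$ within $\hat{\mathcal S}$.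
   Context: Data: integers $K,M\ge1$; vectors $\mathbf h_1,\dots,\mathbf h_K\in\mathbb C^M$; scalars $\gamma_k>0$, $\sigma_k^2>0$. Put $\mathbf C(\beta)=\mathbf B+\sum_{j=1}^K\beta_j\mathbf h_j\mathbf h_j^{H}$. GDB problem: minimize $\operatorname{tr}(\mathbf B\sum_{k}\mathbf V_k)$ over Hermitian $\mathbf V_1,\dots,\mathbf V_K\succeq0$ subject to $(1+\frac1{\gamma_k})\mathbf h_k^{H}\mathbf V_k\mathbf h_k\ge\sum_{j=1}^K\mathbf h_k^{H}\mathbf V_j\mathbf h_k+\sigma_k^2$ for all $k$. It is assumed feasible; "bounded" means its infimum is $>-\infty$. Dual problem: maximize $\sum_k\beta_k\sigma_k^2$ over $\beta\in\mathbb R^K$, $\beta\ge0$, subject to $\mathbf C(\beta)\succeq\frac{\beta_k(\gamma_k+1)}{\gamma_k}\mathbf h_k\mathbf h_k^{H}$ for all $k$. Its optimal solution is denoted $\beta^\star$. Interference function: $I(\beta)=[I_1(\beta),\dots,I_K(\beta)]^{T}$, $I_k(\beta)=\frac{\gamma_k}{\gamma_k+1}\frac{1}{\mathbf h_k^{H}\mathbf C(\beta)^{-1}\mathbf h_k}$ (pseudoinverse if $\mathbf C(\beta)\succeq0$ is singular with all $\mathbf h_k$ in its range). $\mathcal F_1=\{\beta\ge0:\ \mathbf C(\beta)\succeq0,\ \mathbf h_1,\dots,\mathbf h_K\in\operatorname{range}\mathbf C(\beta)\}$ and $\mathcal F=\mathcal F_1\cap\{\beta:\beta\le I(\beta)\}$.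 Vector inequalities are component-wise. *)

theory Defs
  imports "HOL-Analysis.Analysis"
begin

definition conj_transpose :: "complex^'n^'m \<Rightarrow> complex^'m^'n" where
  "conj_transpose A = (\<chi> i j. cnj (A $ j $ i))"

definition hermitian :: "complex^'m^'m \<Rightarrow> bool" where
  "hermitian A \<longleftrightarrow> conj_transpose A = A"

definition outer :: "complex^'m \<Rightarrow> complex^'m^'m" where
  "outer x = (\<chi> i j. x $ i * cnj (x $ j))"

text \<open>The form \<open>x\<^sup>H A x\<close>. It is real for every Hermitian \<open>A\<close>, the only case in
  which it is used, so taking the real part merely changes the type.\<close>

definition quad_form :: "complex^'m^'m \<Rightarrow> complex^'m \<Rightarrow> real" where
  "quad_form A x = Re (\<Sum>i\<in>UNIV. cnj (x $ i) * (A *v x) $ i)"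

definition pos_semidef :: "complex^'m^'m \<Rightarrow> bool" where
  "pos_semidef A \<longleftrightarrow> hermitian A \<and> (\<forall>x. 0 \<le> quad_form A x)"

definition pos_def :: "complex^'m^'m \<Rightarrow> bool" where
  "pos_def A \<longleftrightarrow> hermitian A \<and> (\<forall>x. x \<noteq> 0 \<longrightarrow> 0 < quad_form A x)"

text \<open>The Moore-Penrose pseudoinverse, characterized by the four Penrose equations.\<close>

definition pseudoinverse :: "complex^'m^'m \<Rightarrow> complex^'m^'m" where
  "pseudoinverse A = (THE X. A ** X ** A = A \<and> X ** A ** X = X \<and>
     hermitian (A ** X) \<and> hermitian (X ** A))"

definition ginverse :: "complex^'m^'m \<Rightarrow> complex^'m^'m" where
  "ginverse A = (if invertible A then matrix_inv A else pseudoinverse A)"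

definition Cmat :: "complex^'m^'m \<Rightarrow> ('k::finite \<Rightarrow> complex^'m) \<Rightarrow> real^'k \<Rightarrow> complex^'m^'m" where
  "Cmat B h \<beta> = B + (\<Sum>j\<in>UNIV. (\<beta> $ j) *\<^sub>R outer (h j))"

text \<open>The downlink problem. Its optimal value lives in the extended reals: it is \<open>\<infinity>\<close> if the
  problem is infeasible and \<open>-\<infinity>\<close> if it is unbounded.\<close>

definition gdb_feasible ::
  "('k::finite \<Rightarrow> complex^'m) \<Rightarrow> ('k \<Rightarrow> real) \<Rightarrow> ('k \<Rightarrow> real) \<Rightarrow> ('k \<Rightarrow> complex^'m^'m) set" where
  "gdb_feasible h \<gamma> \<sigma> = {V. (\<forall>k. pos_semidef (V k)) \<and>
     (\<forall>k. (1 + 1 / \<gamma> k) * quad_form (V k) (h k)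
            \<ge> (\<Sum>j\<in>UNIV. quad_form (V j) (h k)) + (\<sigma> k)\<^sup>2)}"

definition gdb_objective :: "complex^'m^'m \<Rightarrow> ('k::finite \<Rightarrow> complex^'m^'m) \<Rightarrow> real" where
  "gdb_objective B V = Re (trace (B ** (\<Sum>k\<in>UNIV. V k)))"

definition gdb_value ::
  "complex^'m^'m \<Rightarrow> ('k::finite \<Rightarrow> complex^'m) \<Rightarrow> ('k \<Rightarrow> real) \<Rightarrow> ('k \<Rightarrow> real) \<Rightarrow> ereal" where
  "gdb_value B h \<gamma> \<sigma> = (INF V\<in>gdb_feasible h \<gamma> \<sigma>. ereal (gdb_objective B V))"

definition dual_feasible ::
  "complex^'m^'m \<Rightarrow> ('k::finite \<Rightarrow> complex^'m) \<Rightarrow> ('k \<Rightarrow> real) \<Rightarrow> (real^'k) set" where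
  "dual_feasible B h \<gamma> = {\<beta>. 0 \<le> \<beta> \<and>
     (\<forall>k. pos_semidef (Cmat B h \<beta> - (\<beta> $ k * (\<gamma> k + 1) / \<gamma> k) *\<^sub>R outer (h k)))}"

definition dual_objective :: "('k::finite \<Rightarrow> real) \<Rightarrow> real^'k \<Rightarrow> real" where
  "dual_objective \<sigma> \<beta> = (\<Sum>k\<in>UNIV. \<beta> $ k * (\<sigma> k)\<^sup>2)"

definition dual_solutions ::
  "complex^'m^'m \<Rightarrow> ('k::finite \<Rightarrow> complex^'m) \<Rightarrow> ('k \<Rightarrow> real) \<Rightarrow> ('k \<Rightarrow> real) \<Rightarrow> (real^'k) set" where
  "dual_solutions B h \<gamma> \<sigma> = {\<beta> \<in> dual_feasible B h \<gamma>.
     \<forall>\<beta>' \<in> dual_feasible B h \<gamma>. dual_objective \<sigma> \<beta>' \<le> dual_objective \<sigma> \<beta>}"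

text \<open>The interference function is meaningful on \<open>F1\<close> below; elsewhere its values are irrelevant.\<close>

definition interference ::
  "complex^'m^'m \<Rightarrow> ('k::finite \<Rightarrow> complex^'m) \<Rightarrow> ('k \<Rightarrow> real) \<Rightarrow> real^'k \<Rightarrow> real^'k" where
  "interference B h \<gamma> \<beta> =
     (\<chi> k. \<gamma> k / (\<gamma> k + 1) * (1 / quad_form (ginverse (Cmat B h \<beta>)) (h k)))"

definition F1 :: "complex^'m^'m \<Rightarrow> ('k::finite \<Rightarrow> complex^'m) \<Rightarrow> (real^'k) set" where
  "F1 B h = {\<beta>. 0 \<le> \<beta> \<and> pos_semidef (Cmat B h \<beta>) \<and>
     (\<forall>k. h k \<in> range (\<lambda>x. Cmat B h \<beta> *v x))}"

text \<open>The order on \<^typ>\<open>real^'k\<close> is component-wise (\<open>less_eq_vec_def\<close>).\<close>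

definition F :: "complex^'m^'m \<Rightarrow> ('k::finite \<Rightarrow> complex^'m) \<Rightarrow> ('k \<Rightarrow> real) \<Rightarrow> (real^'k) set" where
  "F B h \<gamma> = F1 B h \<inter> {\<beta>. \<beta> \<le> interference B h \<gamma> \<beta>}"

end

theory Submission
  imports Defs
begin

text \<open>For positive definite \<open>C\<close> and \<open>v \<noteq> 0\<close>, Cauchy-Schwarz gives
  \<open>c v\<^sup>H C\<^sup>-\<^sup>1 v \<le> 1\<close> iff \<open>C - c v v\<^sup>H\<close> is positive semidefinite. Hence on \<open>\<beta> \<ge> \<beta>hat\<close> dual
  feasibility is \<open>\<beta> \<le> I(\<beta>)\<close>, and \<open>I\<close> is monotone and concave because \<open>C(\<beta>)\<close> is monotone and affine.
  A feasible downlink point bounds the dual feasible set by weak duality, so the componentwise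
  supremum \<open>p\<close> of \<open>{\<beta> \<ge> \<beta>hat. \<beta> \<le> I(\<beta>)}\<close> exists and, as in Knaster-Tarski, is a fixed point.
  The componentwise maximum of a dual feasible point with \<open>\<beta>hat\<close> is again dual feasible, so \<open>p\<close> is the
  greatest dual feasible point and thus the only dual optimum. Slater's condition says
  \<open>I(\<beta>hat) > \<beta>hat\<close>, which together with concavity makes \<open>I\<close> contract towards \<open>p\<close>.\<close>

subsection \<open>Hermitian forms\<close>

text \<open>Complex-valued and conjugate-linear in the first argument: Cauchy-Schwarz and the forms
  of rank-one matrices need the modulus of this inner product, not only its real part.\<close>

definition cip :: "complex^'m \<Rightarrow> complex^'m \<Rightarrow> complex" where
  "cip x y = (\<Sum>i\<in>UNIV. cnj (x $ i) * y $ i)"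

lemma quad_form_cip: "quad_form A x = Re (cip x (A *v x))"
  by (simp add: quad_form_def cip_def)

lemma cip_diff_left: "cip (x - y) z = cip x z - cip y z"
  by (simp add: cip_def left_diff_distrib sum_subtractf)

lemma cip_diff_right: "cip x (y - z) = cip x y - cip x z"
  by (simp add: cip_def right_diff_distrib sum_subtractf)

lemma cip_add_right: "cip x (y + z) = cip x y + cip x z"
  by (simp add: cip_def distrib_left sum.distrib)

lemma cip_scale_left: "cip (a *s x) y = cnj a * cip x y"
  by (simp add: cip_def sum_distrib_left algebra_simps)

lemma cip_scale_right: "cip x (a *s y) = a * cip x y"
  by (simp add: cip_def sum_distrib_left algebra_simps)

lemma cip_commute: "cip y x = cnj (cip x y)"
  by (simp add: cip_def mult.commute)

lemma cip_axis_right: "cip x (axis j 1) = cnj (x $ j)"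
  by (simp add: cip_def axis_def if_distrib cong: if_cong)

lemma cip_hermitian:
  assumes "hermitian A"
  shows "cip (A *v x) y = cip x (A *v y)"
proof -
  have c: "cnj (A $ i $ j) = A $ j $ i" for i j
    using assms unfolding hermitian_def conj_transpose_def by (metis (no_types) vec_lambda_beta)
  have "cip (A *v x) y = (\<Sum>i\<in>UNIV. \<Sum>j\<in>UNIV. A $ j $ i * cnj (x $ j) * y $ i)"
    by (simp add: cip_def matrix_vector_mult_def sum_distrib_right c)
  also have "\<dots> = (\<Sum>j\<in>UNIV. \<Sum>i\<in>UNIV. A $ j $ i * cnj (x $ j) * y $ i)"
    by (rule sum.swap)
  also have "\<dots> = cip x (A *v y)"
    by (simp add: cip_def matrix_vector_mult_def sum_distrib_left algebra_simps)
  finally show ?thesis .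
qed

text \<open>Moving \<open>A\<close> to the other argument turns the value into its own conjugate, so
  its imaginary part vanishes.\<close>

lemma cip_form_eq_quad_form:
  assumes "hermitian A"
  shows "cip x (A *v x) = of_real (quad_form A x)"
proof -
  have "cip x (A *v x) = cnj (cip x (A *v x))"
    using cip_hermitian[OF assms, of x x] cip_commute[of "A *v x" x] by simp
  then show ?thesis
    by (simp add: quad_form_cip complex_eq_iff)
qed

lemma quad_form_zero_vec [simp]: "quad_form A 0 = 0"
  by (simp add: quad_form_def)

lemma quad_form_add: "quad_form (A + B) x = quad_form A x + quad_form B x"
  by (simp add: quad_form_cip matrix_vector_mult_add_rdistrib cip_add_right)

lemma quad_form_diff: "quad_form (A - B) x = quad_form A x - quad_form B x"
  by (simp add: quad_form_cip matrix_vector_mult_diff_rdistrib cip_diff_right)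

lemma quad_form_scaleR: "quad_form (c *\<^sub>R A) x = c * quad_form A x"
proof -
  have "(c *\<^sub>R A) *v x = c *\<^sub>R (A *v x)"
    by (simp add: matrix_vector_mult_def vec_eq_iff scaleR_sum_right)
  moreover have "cip x (c *\<^sub>R y) = c *\<^sub>R cip x y" for y
    by (simp add: cip_def scaleR_sum_right)
  ultimately show ?thesis by (simp add: quad_form_cip)
qed

lemma quad_form_sum: "quad_form (\<Sum>i\<in>S. A i) x = (\<Sum>i\<in>S. quad_form (A i) x)"
proof (induction S rule: infinite_finite_induct)
  case (insert a S)
  then show ?case by (simp add: quad_form_add)
qed (simp_all add: quad_form_def)

lemma outer_mult_vec: "outer v *v x = cip v x *s v"
  by (simp add: outer_def cip_def matrix_vector_mult_def vec_eq_iff sum_distrib_left mult_ac)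

lemma quad_form_outer: "quad_form (outer v) x = (cmod (cip v x))\<^sup>2"
  by (simp add: quad_form_cip outer_mult_vec cip_scale_right cip_commute[of x v]
      cmod_power2 flip: power2_eq_square)

lemma hermitian_outer [simp]: "hermitian (outer v)"
  by (simp add: hermitian_def conj_transpose_def outer_def vec_eq_iff mult.commute)

lemma hermitian_add: "hermitian A \<Longrightarrow> hermitian B \<Longrightarrow> hermitian (A + B)"
  by (simp add: hermitian_def conj_transpose_def vec_eq_iff)

lemma hermitian_diff: "hermitian A \<Longrightarrow> hermitian B \<Longrightarrow> hermitian (A - B)"
  by (simp add: hermitian_def conj_transpose_def vec_eq_iff)

lemma hermitian_scaleR: "hermitian A \<Longrightarrow> hermitian (c *\<^sub>R A)"
  by (simp add: hermitian_def conj_transpose_def vec_eq_iff complex_cnj_scaleR)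

lemma hermitian_sum: "(\<And>i. i \<in> S \<Longrightarrow> hermitian (A i)) \<Longrightarrow> hermitian (\<Sum>i\<in>S. A i)"
proof (induction S rule: infinite_finite_induct)
  case (insert a S)
  then show ?case by (simp add: hermitian_add)
qed (simp_all add: hermitian_def conj_transpose_def vec_eq_iff)

lemma quad_form_diff_scale:
  assumes "hermitian A"
  shows "quad_form A (x - a *s y) =
    quad_form A x - 2 * Re (cnj a * cip (A *v y) x) + (cmod a)\<^sup>2 * quad_form A y"
proof -
  have "cip x (A *v y) = cnj (cip (A *v y) x)"
    by (rule cip_commute)
  moreover have "cip y (A *v x) = cip (A *v y) x"
    by (simp add: cip_hermitian[OF assms])
  moreover have "cip y (A *v y) = of_real (quad_form A y)"
    by (rule cip_form_eq_quad_form[OF assms])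
  ultimately have expand: "cip (x - a *s y) (A *v (x - a *s y)) =
      cip x (A *v x) - a * cnj (cip (A *v y) x) - cnj a * cip (A *v y) x
      + of_real ((cmod a)\<^sup>2 * quad_form A y)"
    by (simp add: matrix_vector_mult_diff_distrib vector_scalar_commute
        cip_diff_left cip_diff_right cip_scale_left cip_scale_right algebra_simps
        complex_norm_square del: of_real_power)
  show ?thesis
    unfolding quad_form_cip[of A "x - a *s y"] expand by (simp add: quad_form_cip[of A x] algebra_simps)
qed

text \<open>The form is nonnegative at \<open>x - (of_real t * w) *s y\<close> for every real
  \<open>t\<close>. The factor \<open>w\<close> aligns the phase, so that what remains is a real
  quadratic in \<open>t\<close>.\<close>

lemma pos_semidef_Cauchy_Schwarz:
  assumes "pos_semidef A"
  shows "(cmod (cip (A *v y) x))\<^sup>2 \<le> quad_form A x * quad_form A y"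
proof -
  define w where "w = cip (A *v y) x"
  have herm: "hermitian A" and nn: "\<And>x. 0 \<le> quad_form A x"
    using assms by (auto simp: pos_semidef_def)
  have ww: "Re (cnj w * w) = (cmod w)\<^sup>2"
    by (simp add: cmod_power2) (simp add: power2_eq_square)
  have expand: "0 \<le> quad_form A x - 2 * t * (cmod w)\<^sup>2 + t\<^sup>2 * (cmod w)\<^sup>2 * quad_form A y" for t :: real
  proof -
    have "Re (cnj (of_real t * w) * w) = t * (cmod w)\<^sup>2"
      unfolding ww[symmetric] by (simp add: algebra_simps)
    then show ?thesis
      using nn[of "x - (of_real t * w) *s y"]
      unfolding quad_form_diff_scale[OF herm] w_def[symmetric]
      by (simp add: norm_mult power_mult_distrib)
  qed
  show ?thesis
  proof (cases "quad_form A y = 0")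
    case True
    \<comment> \<open>Here the quadratic degenerates to a linear function of \<open>t\<close>; if
      \<open>w\<close> were nonzero, the chosen \<open>t\<close> would make it at most -2.\<close>
    have "w = 0"
    proof (rule ccontr)
      assume "w \<noteq> 0"
      then show False
        using expand[of "(quad_form A x + 1) / (cmod w)\<^sup>2"] True nn[of x]
        by simp
    qed
    then show ?thesis using True by (simp add: w_def)
  next
    case False
    then have pos: "0 < quad_form A y"
      using nn[of y] by simp
    \<comment> \<open>The value \<open>t = 1 / quad_form A y\<close> minimizes the
      quadratic.\<close>
    have "0 \<le> quad_form A x - (cmod w)\<^sup>2 / quad_form A y"
      using expand[of "1 / quad_form A y"] pos by (simp add: power2_eq_square)
    then show ?thesis
      using pos by (simp add: w_def field_simps)
  qed
qed

subsection \<open>Positivity of the trace\<close>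

lemma trace_mult_outer: "Re (trace (A ** outer v)) = quad_form A v"
  by (simp add: trace_def matrix_matrix_mult_def outer_def quad_form_def matrix_vector_mult_def
      sum_distrib_left mult_ac)

lemma trace_scaleR: "trace (c *\<^sub>R A) = c *\<^sub>R trace (A :: complex^'m^'m)"
  by (simp add: trace_def scaleR_sum_right)

lemma trace_sum: "trace (\<Sum>i\<in>S. A i) = (\<Sum>i\<in>S. trace (A i))"
  by (simp add: trace_def sum.swap[of _ S])

lemma matrix_diff_ldistrib: "A ** (B - C) = A ** B - A ** (C :: complex^'m^'n)"
  by (simp add: matrix_matrix_mult_def vec_eq_iff right_diff_distrib sum_subtractf)

lemma matrix_sum_ldistrib:
  "A ** (\<Sum>i\<in>S. B i) = (\<Sum>i\<in>S. A ** (B i :: complex^'m^'n))"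
proof (induction S rule: infinite_finite_induct)
  case (insert a S)
  then show ?case by (simp add: matrix_add_ldistrib)
qed (simp_all add: matrix_matrix_mult_def vec_eq_iff)

lemma matrix_vector_mult_axis: "((A :: complex^'n^'m) *v axis i 1) $ j = A $ j $ i"
  by (simp add: matrix_vector_mult_def axis_def if_distrib cong: if_cong)

text \<open>Subtracting the rank-one Schur complement term clears one diagonal entry of \<open>V\<close> at a time.\<close>

lemma trace_mult_pos_semidef_nonneg:
  assumes A: "pos_semidef A" and V: "pos_semidef V"
  shows "0 \<le> Re (trace (A ** V))"
  using V
proof (induction "card {i. quad_form V (axis i 1) \<noteq> 0}" arbitrary: V rule: less_induct)
  case less
  have herm: "hermitian V" and nn: "\<And>x. 0 \<le> quad_form V x"
    using less.prems by (auto simp: pos_semidef_def)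
  show ?case
  proof (cases "\<exists>i. quad_form V (axis i 1) \<noteq> 0")
    case False
    \<comment> \<open>Cauchy-Schwarz bounds each entry by two diagonal entries, all of which are
      zero.\<close>
    have "V $ j $ i = 0" for i j
      using pos_semidef_Cauchy_Schwarz[OF less.prems, of "axis i 1" "axis j 1"] False
      by (simp add: cip_axis_right matrix_vector_mult_axis)
    then have "V = 0"
      by (simp add: vec_eq_iff)
    then show ?thesis
      by (simp add: trace_def matrix_matrix_mult_def)
  next
    case True
    then obtain i where i: "quad_form V (axis i 1) \<noteq> 0" by blast
    define e :: "complex^'a" where "e = axis i 1"
    define d where "d = quad_form V e"
    have d: "0 < d"
      using i nn[of e] by (simp add: d_def e_def)
    define V' where "V' = V - (1 / d) *\<^sub>R outer (V *v e)"
    have q': "quad_form V' x = quad_form V x - (cmod (cip (V *v e) x))\<^sup>2 / d" for x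
      by (simp add: V'_def quad_form_diff quad_form_scaleR quad_form_outer)
    have psd: "pos_semidef V'"
      unfolding pos_semidef_def
    proof (intro conjI allI)
      show "hermitian V'"
        unfolding V'_def by (intro hermitian_diff herm hermitian_scaleR hermitian_outer)
      show "0 \<le> quad_form V' x" for x
        using pos_semidef_Cauchy_Schwarz[OF less.prems, of e x] d
        by (simp add: q' d_def[symmetric] field_simps)
    qed
    have "cip (V *v e) e = of_real d"
      using cip_form_eq_quad_form[OF herm, of e] cip_hermitian[OF herm, of e e]
      by (simp add: d_def)
    then have "quad_form V' e = 0"
      using d by (simp add: q' d_def[symmetric] power2_eq_square)
    \<comment> \<open>The form of \<open>V'\<close> lies between 0 and that of \<open>V\<close>, so
      zero diagonal entries stay zero; with the new zero at \<open>e\<close> the induction measure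
      strictly drops.\<close>
    moreover have "quad_form V' x = 0" if "quad_form V x = 0" for x
    proof -
      have "0 \<le> quad_form V' x" using psd by (simp add: pos_semidef_def)
      moreover have "quad_form V' x \<le> 0" using that d by (simp add: q')
      ultimately show ?thesis by simp
    qed
    ultimately have "{i. quad_form V' (axis i 1) \<noteq> 0} \<subset> {i. quad_form V (axis i 1) \<noteq> 0}"
      using i by (auto simp: e_def)
    then have "card {i. quad_form V' (axis i 1) \<noteq> 0} < card {i. quad_form V (axis i 1) \<noteq> 0}"
      by (intro psubset_card_mono) auto
    then have "0 \<le> Re (trace (A ** V'))"
      using less.hyps psd by blast
    moreover have "V = V' + (1 / d) *\<^sub>R outer (V *v e)"
      by (simp add: V'_def)
    then have "trace (A ** V) = trace (A ** (V' + (1 / d) *\<^sub>R outer (V *v e)))"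
      by simp
    then have "Re (trace (A ** V)) = Re (trace (A ** V')) + quad_form A (V *v e) / d"
      by (simp add: matrix_add_ldistrib trace_add matrix_scalar_ac trace_scaleR trace_mult_outer
          flip: scalar_matrix_assoc)
    moreover have "0 \<le> quad_form A (V *v e)"
      using A by (simp add: pos_semidef_def)
    ultimately show ?thesis
      using d by simp
  qed
qed

subsection \<open>Rank-one perturbations of positive definite matrices\<close>

lemma pos_def_invertible:
  assumes "pos_def A"
  shows "invertible A"
proof -
  have "x = 0" if "A *v x = 0" for x
  proof (rule ccontr)
    assume "x \<noteq> 0"
    then have "0 < quad_form A x" using assms by (simp add: pos_def_def)
    then show False using that by (simp add: quad_form_cip cip_def)
  qed
  then show ?thesis
    by (simp add: invertible_left_inverse matrix_left_invertible_ker)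
qed

lemma pos_def_imp_pos_semidef: "pos_def A \<Longrightarrow> pos_semidef A"
  by (metis less_eq_real_def pos_def_def pos_semidef_def quad_form_zero_vec)

text \<open>Writing \<open>v\<close> as \<open>A *v y\<close> trades the form of the inverse at
  \<open>v\<close> for the form of \<open>A\<close> at \<open>y\<close>, so later arguments need
  only Cauchy-Schwarz for \<open>A\<close>.\<close>

lemma pos_def_solve:
  assumes "pos_def A"
  obtains y where "A *v y = v" "quad_form (ginverse A) v = quad_form A y"
proof
  define y where "y = matrix_inv A *v v"
  have inv: "invertible A" by (rule pos_def_invertible[OF assms])
  have herm: "hermitian A" using assms by (simp add: pos_def_def)
  have "A ** matrix_inv A = mat 1"
    using inv unfolding invertible_def matrix_inv_def by (metis (mono_tags, lifting) someI_ex)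
  then show Ay: "A *v y = v"
    by (simp add: y_def matrix_vector_mul_assoc)
  have "quad_form (ginverse A) v = Re (cip (A *v y) y)"
    using inv by (simp add: quad_form_cip ginverse_def Ay) (simp add: y_def)
  then show "quad_form (ginverse A) v = quad_form A y"
    by (simp add: quad_form_cip cip_hermitian[OF herm])
qed

lemma quad_form_ginverse_pos:
  assumes "pos_def A" "v \<noteq> 0"
  shows "0 < quad_form (ginverse A) v"
proof -
  obtain y where y: "A *v y = v" "quad_form (ginverse A) v = quad_form A y"
    using pos_def_solve[OF assms(1)] .
  then have "y \<noteq> 0" using assms(2) by auto
  then show ?thesis using y assms(1) by (simp add: pos_def_def)
qed

text \<open>The solution \<open>y\<close> of \<open>A *v y = v\<close> is the extremal test vector:
  Cauchy-Schwarz between \<open>y\<close> and \<open>x\<close> gives sufficiency, and evaluating at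
  \<open>y\<close>, where it is tight, gives necessity.\<close>

lemma pos_semidef_minus_outer_iff:
  assumes A: "pos_def A" and v: "v \<noteq> 0"
  shows "pos_semidef (A - c *\<^sub>R outer v) \<longleftrightarrow> c * quad_form (ginverse A) v \<le> 1"
proof -
  obtain y where y: "A *v y = v" "quad_form (ginverse A) v = quad_form A y"
    using pos_def_solve[OF A] .
  have herm: "hermitian A" and psd: "pos_semidef A"
    using A by (auto simp: pos_def_def pos_def_imp_pos_semidef)
  define q where "q = quad_form A y"
  have q: "0 < q" using quad_form_ginverse_pos[OF A v] y by (simp add: q_def)
  have form: "quad_form (A - c *\<^sub>R outer v) x = quad_form A x - c * (cmod (cip v x))\<^sup>2" for x
    by (simp add: quad_form_diff quad_form_scaleR quad_form_outer)
  have vy: "cmod (cip v y) = q"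
    using cip_form_eq_quad_form[OF herm, of y] cip_hermitian[OF herm, of y y] y q
    by (simp add: q_def)
  show ?thesis
    unfolding y(2) q_def[symmetric]
  proof
    assume "pos_semidef (A - c *\<^sub>R outer v)"
    then have "0 \<le> quad_form (A - c *\<^sub>R outer v) y"
      by (simp add: pos_semidef_def)
    then have "c * q * q \<le> 1 * q"
      by (simp add: form vy q_def[symmetric] power2_eq_square)
    then show "c * q \<le> 1"
      using q by (simp only: mult_le_cancel_right_pos)
  next
    assume cq: "c * q \<le> 1"
    show "pos_semidef (A - c *\<^sub>R outer v)"
      unfolding pos_semidef_def
    proof (intro conjI allI)
      show "hermitian (A - c *\<^sub>R outer v)"
        by (intro hermitian_diff herm hermitian_scaleR hermitian_outer)
      fix x
      have nn: "0 \<le> quad_form A x" using psd by (simp add: pos_semidef_def)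
      have cs: "(cmod (cip v x))\<^sup>2 \<le> quad_form A x * q"
        using pos_semidef_Cauchy_Schwarz[OF psd, of y x] by (simp add: y q_def)
      \<comment> \<open>The scalar \<open>c\<close> may have any sign; for negative \<open>c\<close>
        the left side is nonpositive.\<close>
      have "c * (cmod (cip v x))\<^sup>2 \<le> quad_form A x"
      proof (cases "0 \<le> c")
        case True
        have "c * (cmod (cip v x))\<^sup>2 \<le> c * (quad_form A x * q)"
          using cs True by (rule mult_left_mono)
        also have "\<dots> = quad_form A x * (c * q)" by simp
        also have "\<dots> \<le> quad_form A x" using cq nn by (rule mult_left_le)
        finally show ?thesis .
      next
        case False
        then have "c * (cmod (cip v x))\<^sup>2 \<le> 0" by (simp add: mult_nonpos_nonneg)
        then show ?thesis using nn by simp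
      qed
      then show "0 \<le> quad_form (A - c *\<^sub>R outer v) x"
        by (simp add: form)
    qed
  qed
qed

text \<open>Strict counterpart, by evaluation at the same nonzero test vector \<open>y\<close>; it
  turns Slater's condition into a strict inequality for the interference function.\<close>

lemma pos_def_minus_outer_imp_less:
  assumes A: "pos_def A" and v: "v \<noteq> 0" and pd: "pos_def (A - c *\<^sub>R outer v)"
  shows "c * quad_form (ginverse A) v < 1"
proof -
  obtain y where y: "A *v y = v" "quad_form (ginverse A) v = quad_form A y"
    using pos_def_solve[OF A] .
  have herm: "hermitian A" using A by (simp add: pos_def_def)
  define q where "q = quad_form A y"
  have q: "0 < q" using quad_form_ginverse_pos[OF A v] y by (simp add: q_def)
  have vy: "cmod (cip v y) = q"
    using cip_form_eq_quad_form[OF herm, of y] cip_hermitian[OF herm, of y y] y q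
    by (simp add: q_def)
  have "y \<noteq> 0" using y v by auto
  then have "0 < quad_form (A - c *\<^sub>R outer v) y"
    using pd by (simp add: pos_def_def)
  then have "c * q * q < 1 * q"
    by (simp add: quad_form_diff quad_form_scaleR quad_form_outer vy q_def[symmetric]
        power2_eq_square)
  then show ?thesis
    unfolding y(2) q_def[symmetric] using q by (simp only: mult_less_cancel_right_pos)
qed

subsection \<open>Iterating monotone concave maps\<close>

text \<open>With \<open>d = p - a\<close> and \<open>c\<close> such that \<open>f a - a \<ge> c d\<close>, concavity shows that one application of
  \<open>f\<close> shrinks the bounds \<open>a + (1 - \<epsilon>) d \<le> x \<le> a + (1 + \<epsilon>') d\<close> by the factor \<open>1 - c\<close>.\<close>

lemma concave_mono_iteration_tendsto:
  fixes f :: "real^'k \<Rightarrow> real^'k"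
  assumes mono: "mono_on {a..} f"
    and conc: "\<And>k. concave_on {a..} (\<lambda>x. f x $ k)"
    and above: "\<And>k. a $ k < f a $ k"
    and fixed: "a \<le> p" "f p = p"
    and x0: "a \<le> x 0" and step: "\<And>n. x (Suc n) = f (x n)"
  shows "x \<longlonglongrightarrow> p"
proof -
  define d where "d = p - a"
  have fap: "f a \<le> p"
    using mono_onD[OF mono, of a p] fixed by simp
  have d: "0 < d $ k" for k
  proof -
    have "f a $ k \<le> p $ k" using fap by (simp add: less_eq_vec_def)
    then show ?thesis using above[of k] by (simp add: d_def)
  qed
  have p_eq: "p $ k = a $ k + d $ k" for k by (simp add: d_def)
  \<comment> \<open>The largest admissible \<open>c\<close>: a minimum over finitely many positive
    ratios, and at most 1 because monotonicity gives \<open>f a \<le> p\<close>.\<close>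
  define c where "c = Min (range (\<lambda>k. (f a $ k - a $ k) / d $ k))"
  have c_le: "c \<le> (f a $ k - a $ k) / d $ k" for k
    by (simp add: c_def)
  have c_pos: "0 < c"
    using above d by (simp add: c_def)
  have fa_ge: "a $ k + c * d $ k \<le> f a $ k" for k
    using c_le[of k] d[of k] by (simp add: field_simps)
  have c_1: "c \<le> 1"
  proof -
    fix k :: 'k
    have "f a $ k - a $ k \<le> d $ k" using fap by (simp add: less_eq_vec_def d_def)
    then have "(f a $ k - a $ k) / d $ k \<le> 1" using d[of k] by simp
    then show ?thesis using c_le[of k] by simp
  qed
  define \<rho> where "\<rho> = 1 - c"
  have \<rho>: "0 \<le> \<rho>" "\<rho> < 1" using c_pos c_1 by (auto simp: \<rho>_def)
  \<comment> \<open>The relative overshoot of \<open>x 0\<close> above \<open>p\<close>; inserting 0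
    ensures \<open>r \<ge> 0\<close>, hence \<open>s \<ge> 1\<close> below.\<close>
  define r where "r = Max (insert 0 (range (\<lambda>k. (x 0 $ k - p $ k) / d $ k)))"
  have r0: "0 \<le> r" by (simp add: r_def)
  have r_ge: "x 0 $ k \<le> a $ k + (1 + r) * d $ k" for k
  proof -
    have "(x 0 $ k - p $ k) / d $ k \<le> r"
      unfolding r_def by (rule Max_ge) auto
    then show ?thesis using d[of k] by (simp add: p_eq field_simps)
  qed
  have above_a: "a \<le> a + t *\<^sub>R d" if "0 \<le> t" for t
    using that d by (simp add: less_eq_vec_def less_imp_le)
  have bounds: "a + (1 - \<rho> ^ n) *\<^sub>R d \<le> x n \<and> x n \<le> a + (1 + r * \<rho> ^ n) *\<^sub>R d" for n
  proof (induction n)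
    case 0
    then show ?case using x0 r_ge by (simp add: less_eq_vec_def)
  next
    case (Suc n)
    define t where "t = 1 - \<rho> ^ n"
    define s where "s = 1 + r * \<rho> ^ n"
    have \<rho>n: "0 \<le> \<rho> ^ n" "\<rho> ^ n \<le> 1" using \<rho> by (auto simp: power_le_one)
    have t: "0 \<le> t" "t \<le> 1" using \<rho>n by (auto simp: t_def)
    have s: "1 \<le> s" using \<rho>n r0 by (simp add: s_def)
    have lo: "a + t *\<^sub>R d \<le> x n" and hi: "x n \<le> a + s *\<^sub>R d"
      using Suc by (auto simp: t_def s_def)
    have xn: "a \<le> x n" using lo above_a[OF t(1)] by (rule order_trans[rotated])
    have "a $ k + (1 - \<rho> ^ Suc n) * d $ k \<le> x (Suc n) $ k" for k
    proof -
      \<comment> \<open>The lower bound lies on the segment from \<open>a\<close> to the fixed point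
        \<open>p\<close>, so concavity bounds \<open>f\<close> there from below.\<close>
      have "(1 - t) *\<^sub>R a + t *\<^sub>R p = a + t *\<^sub>R d"
        by (simp add: d_def algebra_simps)
      then have "(1 - t) * f a $ k + t * p $ k \<le> f (a + t *\<^sub>R d) $ k"
        using concave_onD[OF conc[of k] t, of a p] fixed by simp
      also have "\<dots> \<le> x (Suc n) $ k"
        using mono_onD[OF mono, of "a + t *\<^sub>R d" "x n"] lo xn above_a[OF t(1)]
        by (simp add: step less_eq_vec_def)
      finally have "(1 - t) * f a $ k + t * p $ k \<le> x (Suc n) $ k" .
      moreover have "(1 - t) * (a $ k + c * d $ k) \<le> (1 - t) * f a $ k"
        using fa_ge t by (intro mult_left_mono) auto
      ultimately have "(1 - t) * (a $ k + c * d $ k) + t * p $ k \<le> x (Suc n) $ k"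
        by simp
      then show ?thesis
        by (simp add: p_eq t_def \<rho>_def algebra_simps)
    qed
    moreover have "x (Suc n) $ k \<le> a $ k + (1 + r * \<rho> ^ Suc n) * d $ k" for k
    proof -
      define y where "y = a + s *\<^sub>R d"
      have ay: "a \<le> y" using above_a s by (simp add: y_def)
      \<comment> \<open>Now \<open>p\<close> lies between \<open>a\<close> and the upper bound
        \<open>y\<close>, so concavity at \<open>p\<close> bounds \<open>f y\<close> from above by
        extrapolation: \<open>f y \<le> s p - (s - 1) f a\<close>.\<close>
      have "(1 - 1 / s) *\<^sub>R a + (1 / s) *\<^sub>R y = p"
        using s by (simp add: y_def d_def algebra_simps)
      then have "(1 - 1 / s) * f a $ k + (1 / s) * f y $ k \<le> p $ k"
        using concave_onD[OF conc[of k], of "1 / s" a y] ay s fixed by simp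
      then have "s * ((1 - 1 / s) * f a $ k + (1 / s) * f y $ k) \<le> s * p $ k"
        using s by (intro mult_left_mono) auto
      moreover have "s * ((1 - 1 / s) * f a $ k + (1 / s) * f y $ k) = (s - 1) * f a $ k + f y $ k"
        using s by (simp add: field_simps)
      moreover have "(s - 1) * (a $ k + c * d $ k) \<le> (s - 1) * f a $ k"
        using fa_ge s by (intro mult_left_mono) auto
      moreover have "x (Suc n) $ k \<le> f y $ k"
        using mono_onD[OF mono, of "x n" y] hi xn ay by (simp add: step less_eq_vec_def y_def)
      ultimately have "x (Suc n) $ k \<le> s * p $ k - (s - 1) * (a $ k + c * d $ k)"
        by linarith
      then show ?thesis
        by (simp add: p_eq s_def \<rho>_def algebra_simps)
    qed
    ultimately show ?case by (simp add: less_eq_vec_def)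
  qed
  have pw: "(\<lambda>n. \<rho> ^ n) \<longlonglongrightarrow> 0"
    using \<rho> by (intro LIMSEQ_power_zero) auto
  show ?thesis
  proof (rule vec_tendstoI)
    fix k
    show "(\<lambda>n. x n $ k) \<longlonglongrightarrow> p $ k"
    proof (rule tendsto_sandwich)
      show "\<forall>\<^sub>F n in sequentially. a $ k + (1 - \<rho> ^ n) * d $ k \<le> x n $ k"
        "\<forall>\<^sub>F n in sequentially. x n $ k \<le> a $ k + (1 + r * \<rho> ^ n) * d $ k"
        using bounds by (auto simp: less_eq_vec_def)
      have "(\<lambda>n. a $ k + (1 - \<rho> ^ n) * d $ k) \<longlonglongrightarrow> a $ k + (1 - 0) * d $ k"
        by (intro tendsto_intros pw)
      then show "(\<lambda>n. a $ k + (1 - \<rho> ^ n) * d $ k) \<longlonglongrightarrow> p $ k" by (simp add: p_eq)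
      have "(\<lambda>n. a $ k + (1 + r * \<rho> ^ n) * d $ k) \<longlonglongrightarrow> a $ k + (1 + r * 0) * d $ k"
        by (intro tendsto_intros pw)
      then show "(\<lambda>n. a $ k + (1 + r * \<rho> ^ n) * d $ k) \<longlonglongrightarrow> p $ k" by (simp add: p_eq)
    qed
  qed
qed

text \<open>Knaster-Tarski above \<open>a\<close>, where the bounds \<open>u\<close> replace
  completeness of the lattice: they make the componentwise supremum of the post-fixed points
  exist.\<close>

lemma mono_greatest_postfixed_point:
  fixes f :: "real^'k \<Rightarrow> real^'k"
  assumes mono: "mono_on {a..} f" and a: "a \<le> f a"
    and bdd: "\<And>x k. a \<le> x \<Longrightarrow> x \<le> f x \<Longrightarrow> x $ k \<le> u k"
  obtains p where "a \<le> p" "f p = p" "\<And>x. a \<le> x \<Longrightarrow> x \<le> f x \<Longrightarrow> x \<le> p"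
proof
  define S where "S = {x. a \<le> x \<and> x \<le> f x}"
  define p where "p = (\<chi> k. SUP x\<in>S. x $ k)"
  have aS: "a \<in> S" using a by (simp add: S_def)
  have bdd_S: "bdd_above ((\<lambda>x. x $ k) ` S)" for k
    using bdd by (intro bdd_aboveI[of _ "u k"]) (auto simp: S_def)
  have upper: "x \<le> p" if "x \<in> S" for x
    using that bdd_S by (auto simp: less_eq_vec_def p_def intro!: cSUP_upper)
  then show ap: "a \<le> p" using aS by simp
  have "(SUP x\<in>S. x $ k) \<le> f p $ k" for k
  proof (rule cSUP_least)
    show "S \<noteq> {}" using aS by blast
    fix x assume x: "x \<in> S"
    then have "f x \<le> f p" using mono_onD[OF mono, of x p] upper ap by (simp add: S_def)
    moreover have "x \<le> f x" using x by (simp add: S_def)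
    ultimately have "x \<le> f p" by (rule order_trans[rotated])
    then show "x $ k \<le> f p $ k" by (simp add: less_eq_vec_def)
  qed
  then have "p $ k \<le> f p $ k" for k by (simp add: p_def)
  then have pfp: "p \<le> f p" by (simp add: less_eq_vec_def)
  \<comment> \<open>Monotonicity applied to \<open>p \<le> f p\<close> makes \<open>f p\<close> a
    post-fixed point too, so it cannot exceed the supremum.\<close>
  have "a \<le> f p" using ap pfp by (rule order_trans)
  then have "f p \<in> S"
    using mono_onD[OF mono, of p "f p"] ap pfp by (simp add: S_def)
  then have "f p \<le> p" by (rule upper)
  then show "f p = p" using pfp by (rule antisym)
  show "x \<le> p" if "a \<le> x" "x \<le> f x" for x
    using upper that by (simp add: S_def)
qed

subsection \<open>The interference function and the dual problem\<close>

lemma hermitian_Cmat: "hermitian B \<Longrightarrow> hermitian (Cmat B h \<beta>)"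
  unfolding Cmat_def by (intro hermitian_add hermitian_sum hermitian_scaleR hermitian_outer)

lemma quad_form_Cmat:
  "quad_form (Cmat B h \<beta>) x = quad_form B x + (\<Sum>j\<in>UNIV. \<beta> $ j * (cmod (cip (h j) x))\<^sup>2)"
  by (simp add: Cmat_def quad_form_add quad_form_sum quad_form_scaleR quad_form_outer)

lemma quad_form_Cmat_mono: "\<beta> \<le> \<beta>' \<Longrightarrow> quad_form (Cmat B h \<beta>) x \<le> quad_form (Cmat B h \<beta>') x"
  by (auto simp: quad_form_Cmat less_eq_vec_def intro!: sum_mono mult_right_mono)

lemma pos_def_Cmat_mono:
  assumes "pos_def (Cmat B h \<beta>)" "\<beta> \<le> \<beta>'" "hermitian B"
  shows "pos_def (Cmat B h \<beta>')"
  using assms quad_form_Cmat_mono[OF assms(2), of B h] hermitian_Cmat[OF assms(3)]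
  unfolding pos_def_def by (meson less_le_trans)

lemma pos_semidef_Cmat_minus_outer_iff:
  "hermitian B \<Longrightarrow> pos_semidef (Cmat B h \<beta> - c *\<^sub>R outer v) \<longleftrightarrow>
    (\<forall>x. c * (cmod (cip v x))\<^sup>2 \<le> quad_form (Cmat B h \<beta>) x)"
  by (simp add: pos_semidef_def hermitian_Cmat hermitian_diff hermitian_scaleR quad_form_diff
      quad_form_scaleR quad_form_outer)

lemma interference_nth:
  "interference B h \<gamma> \<beta> $ k = 1 / ((\<gamma> k + 1) / \<gamma> k * quad_form (ginverse (Cmat B h \<beta>)) (h k))"
  by (simp add: interference_def)

text \<open>The rank-one criterion with \<open>c\<close> decoupled from \<open>\<beta>\<close>. It
  exhibits component \<open>k\<close> of the interference function as the largest \<open>c\<close>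
  satisfying a family of inequalities whose right sides are affine and monotone in
  \<open>\<beta>\<close>.\<close>

lemma le_interference_iff:
  assumes "hermitian B" "0 < \<gamma> k" "h k \<noteq> 0" "pos_def (Cmat B h \<beta>)"
  shows "c \<le> interference B h \<gamma> \<beta> $ k \<longleftrightarrow>
    (\<forall>x. c * (\<gamma> k + 1) / \<gamma> k * (cmod (cip (h k) x))\<^sup>2 \<le> quad_form (Cmat B h \<beta>) x)"
proof -
  define q where "q = quad_form (ginverse (Cmat B h \<beta>)) (h k)"
  have q: "0 < q" using quad_form_ginverse_pos[OF assms(4,3)] by (simp add: q_def)
  have "0 < (\<gamma> k + 1) / \<gamma> k * q" using assms(2) q by simp
  then have "c \<le> interference B h \<gamma> \<beta> $ k \<longleftrightarrow> c * ((\<gamma> k + 1) / \<gamma> k * q) \<le> 1"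
    unfolding interference_nth q_def[symmetric] by (rule pos_le_divide_eq)
  also have "\<dots> \<longleftrightarrow> c * (\<gamma> k + 1) / \<gamma> k * q \<le> 1"
    by (simp add: mult.assoc)
  also have "\<dots> \<longleftrightarrow> pos_semidef (Cmat B h \<beta> - (c * (\<gamma> k + 1) / \<gamma> k) *\<^sub>R outer (h k))"
    unfolding q_def by (rule pos_semidef_minus_outer_iff[OF assms(4,3), symmetric])
  finally show ?thesis
    by (simp only: pos_semidef_Cmat_minus_outer_iff[OF assms(1)])
qed

text \<open>Every \<open>c\<close> admissible at \<open>x\<close> stays admissible at
  \<open>y\<close>, since the form of \<open>Cmat\<close> grows.\<close>

lemma interference_mono_on:
  assumes "hermitian B" "\<And>k. 0 < \<gamma> k" "\<And>k. h k \<noteq> 0" "pos_def (Cmat B h a)"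
  shows "mono_on {a..} (interference B h \<gamma>)"
proof (rule mono_onI)
  fix x y assume xy: "x \<in> {a..}" "y \<in> {a..}" "x \<le> y"
  have pd: "pos_def (Cmat B h x)" "pos_def (Cmat B h y)"
    using pos_def_Cmat_mono[OF assms(4) _ assms(1)] xy by auto
  show "interference B h \<gamma> x \<le> interference B h \<gamma> y"
    unfolding less_eq_vec_def
  proof
    fix k
    have "\<forall>z. interference B h \<gamma> x $ k * (\<gamma> k + 1) / \<gamma> k * (cmod (cip (h k) z))\<^sup>2
        \<le> quad_form (Cmat B h x) z"
      using le_interference_iff[of B \<gamma> k h, OF assms(1) assms(2) assms(3) pd(1)] by blast
    then have "\<forall>z. interference B h \<gamma> x $ k * (\<gamma> k + 1) / \<gamma> k * (cmod (cip (h k) z))\<^sup>2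
        \<le> quad_form (Cmat B h y) z"
      using quad_form_Cmat_mono[OF xy(3)] order_trans by blast
    then show "interference B h \<gamma> x $ k \<le> interference B h \<gamma> y $ k"
      using le_interference_iff[of B \<gamma> k h, OF assms(1) assms(2) assms(3) pd(2)] by blast
  qed
qed

text \<open>A convex combination of values admissible at \<open>x\<close> and at \<open>y\<close> is
  admissible at the combined point, since the form of \<open>Cmat\<close> is affine in its
  coefficients.\<close>

lemma interference_concave_on:
  assumes "hermitian B" "0 < \<gamma> k" "h k \<noteq> 0" "pos_def (Cmat B h a)"
  shows "concave_on {a..} (\<lambda>x. interference B h \<gamma> x $ k)"
  unfolding concave_on_iff
proof (intro conjI ballI allI impI)
  have comb: "a \<le> u *\<^sub>R x + v *\<^sub>R y"
    if "a \<le> x" "a \<le> y" "0 \<le> u" "0 \<le> v" "u + v = 1" for x y and u v :: real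
  proof -
    have "a $ k \<le> u * x $ k + v * y $ k" for k
    proof -
      have "u * a $ k + v * a $ k \<le> u * x $ k + v * y $ k"
        using that by (intro add_mono mult_left_mono) (auto simp: less_eq_vec_def)
      moreover have "u * a $ k + v * a $ k = a $ k"
        using that(5) by (metis distrib_right mult_1)
      ultimately show ?thesis by simp
    qed
    then show ?thesis by (simp add: less_eq_vec_def)
  qed
  then show "convex {a..}"
    unfolding convex_def by auto
  fix x y and u v :: real
  assume xy: "x \<in> {a..}" "y \<in> {a..}" and uv: "0 \<le> u" "0 \<le> v" "u + v = 1"
  define w where "w = u *\<^sub>R x + v *\<^sub>R y"
  have "a \<le> w" using comb xy uv by (simp add: w_def)
  then have pd: "pos_def (Cmat B h x)" "pos_def (Cmat B h y)" "pos_def (Cmat B h w)"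
    using pos_def_Cmat_mono[OF assms(4) _ assms(1)] xy by auto
  note iff = le_interference_iff[of B \<gamma> k h, OF assms(1-3)]
  have ix: "\<forall>z. interference B h \<gamma> x $ k * (\<gamma> k + 1) / \<gamma> k * (cmod (cip (h k) z))\<^sup>2
      \<le> quad_form (Cmat B h x) z"
    using iff[OF pd(1)] by blast
  have iy: "\<forall>z. interference B h \<gamma> y $ k * (\<gamma> k + 1) / \<gamma> k * (cmod (cip (h k) z))\<^sup>2
      \<le> quad_form (Cmat B h y) z"
    using iff[OF pd(2)] by blast
  have "(u * interference B h \<gamma> x $ k + v * interference B h \<gamma> y $ k) * (\<gamma> k + 1) / \<gamma> k
      * (cmod (cip (h k) z))\<^sup>2 \<le> quad_form (Cmat B h w) z" (is "?l \<le> _") for z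
  proof -
    have "?l = u * (interference B h \<gamma> x $ k * (\<gamma> k + 1) / \<gamma> k * (cmod (cip (h k) z))\<^sup>2)
        + v * (interference B h \<gamma> y $ k * (\<gamma> k + 1) / \<gamma> k * (cmod (cip (h k) z))\<^sup>2)"
      by (simp add: add_divide_distrib algebra_simps)
    also have "\<dots> \<le> u * quad_form (Cmat B h x) z + v * quad_form (Cmat B h y) z"
      using ix iy uv by (intro add_mono mult_left_mono) auto
    also have "\<dots> = (u + v) * quad_form B z
        + (\<Sum>j\<in>UNIV. (u * x $ j + v * y $ j) * (cmod (cip (h j) z))\<^sup>2)"
      by (simp add: quad_form_Cmat algebra_simps sum.distrib sum_distrib_left)
    also have "\<dots> = quad_form (Cmat B h w) z"
      using uv by (simp add: quad_form_Cmat w_def)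
    finally show ?thesis .
  qed
  then show "u * interference B h \<gamma> x $ k + v * interference B h \<gamma> y $ k
      \<le> interference B h \<gamma> (u *\<^sub>R x + v *\<^sub>R y) $ k"
    using iff[OF pd(3)] by (simp add: w_def)
qed

text \<open>Pair the \<open>k\<close>-th dual slack matrix with \<open>V k\<close>: each trace is
  nonnegative. Summing over \<open>k\<close> and adding the downlink constraints weighted by
  \<open>\<beta> $ k \<ge> 0\<close> gives the inequality.\<close>

lemma gdb_weak_duality:
  assumes V: "V \<in> gdb_feasible h \<gamma> \<sigma>" and \<beta>: "\<beta> \<in> dual_feasible B h \<gamma>"
    and \<gamma>: "\<And>k. 0 < \<gamma> k"
  shows "dual_objective \<sigma> \<beta> \<le> gdb_objective B V"
proof -
  have trC: "Re (trace ((Cmat B h \<beta> - c *\<^sub>R outer v) ** W)) =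
      Re (trace (B ** W)) + (\<Sum>j\<in>UNIV. \<beta> $ j * quad_form W (h j)) - c * quad_form W v" for c v W
  proof -
    have "Re (trace ((Cmat B h \<beta> - c *\<^sub>R outer v) ** W)) =
        Re (trace (W ** (Cmat B h \<beta> - c *\<^sub>R outer v)))"
      by (rule arg_cong[OF trace_mul_sym])
    also have "\<dots> = Re (trace (W ** B)) + (\<Sum>j\<in>UNIV. \<beta> $ j * quad_form W (h j)) - c * quad_form W v"
      by (simp add: Cmat_def matrix_diff_ldistrib matrix_add_ldistrib matrix_sum_ldistrib
          trace_add trace_sub trace_sum trace_scaleR matrix_scalar_ac trace_mult_outer
          flip: scalar_matrix_assoc)
    finally show ?thesis
      unfolding trace_mul_sym[of W B] .
  qed
  have "0 \<le> Re (trace (B ** V k)) + (\<Sum>j\<in>UNIV. \<beta> $ j * quad_form (V k) (h j))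
      - \<beta> $ k * (\<gamma> k + 1) / \<gamma> k * quad_form (V k) (h k)" for k
    unfolding trC[symmetric] using V \<beta>
    by (intro trace_mult_pos_semidef_nonneg) (auto simp: gdb_feasible_def dual_feasible_def)
  then have "0 \<le> (\<Sum>k\<in>UNIV. Re (trace (B ** V k)) + (\<Sum>j\<in>UNIV. \<beta> $ j * quad_form (V k) (h j))
      - \<beta> $ k * (\<gamma> k + 1) / \<gamma> k * quad_form (V k) (h k))"
    by (intro sum_nonneg) auto
  also have "\<dots> = (\<Sum>k\<in>UNIV. Re (trace (B ** V k))) +
      (\<Sum>k\<in>UNIV. \<Sum>j\<in>UNIV. \<beta> $ j * quad_form (V k) (h j))
      - (\<Sum>k\<in>UNIV. \<beta> $ k * (\<gamma> k + 1) / \<gamma> k * quad_form (V k) (h k))"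
    by (simp add: sum.distrib sum_subtractf)
  \<comment> \<open>Regrouped by multiplier, the double sum contains the total received power that
    appears in each downlink constraint.\<close>
  also have "(\<Sum>k\<in>UNIV. \<Sum>j\<in>UNIV. \<beta> $ j * quad_form (V k) (h j)) =
      (\<Sum>j\<in>UNIV. \<beta> $ j * (\<Sum>k\<in>UNIV. quad_form (V k) (h j)))"
    by (subst sum.swap) (simp add: sum_distrib_left)
  also have "(\<Sum>k\<in>UNIV. Re (trace (B ** V k))) = gdb_objective B V"
    by (simp add: gdb_objective_def matrix_sum_ldistrib trace_sum)
  finally have "(\<Sum>k\<in>UNIV. \<beta> $ k * (\<gamma> k + 1) / \<gamma> k * quad_form (V k) (h k))
      - (\<Sum>j\<in>UNIV. \<beta> $ j * (\<Sum>k\<in>UNIV. quad_form (V k) (h j))) \<le> gdb_objective B V"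
    by simp
  moreover have "dual_objective \<sigma> \<beta> \<le>
      (\<Sum>k\<in>UNIV. \<beta> $ k * (\<gamma> k + 1) / \<gamma> k * quad_form (V k) (h k)
        - \<beta> $ k * (\<Sum>j\<in>UNIV. quad_form (V j) (h k)))"
    unfolding dual_objective_def
  proof (rule sum_mono)
    fix k
    have "0 \<le> \<beta> $ k" using \<beta> by (simp add: dual_feasible_def less_eq_vec_def)
    moreover have "(\<sigma> k)\<^sup>2 \<le> (1 + 1 / \<gamma> k) * quad_form (V k) (h k)
        - (\<Sum>j\<in>UNIV. quad_form (V j) (h k))"
      using V by (simp add: gdb_feasible_def le_diff_eq add.commute)
    ultimately have "\<beta> $ k * (\<sigma> k)\<^sup>2 \<le> \<beta> $ k * ((1 + 1 / \<gamma> k) * quad_form (V k) (h k)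
        - (\<Sum>j\<in>UNIV. quad_form (V j) (h k)))"
      by (rule mult_left_mono[rotated])
    also have "\<dots> = \<beta> $ k * (\<gamma> k + 1) / \<gamma> k * quad_form (V k) (h k)
        - \<beta> $ k * (\<Sum>j\<in>UNIV. quad_form (V j) (h k))"
      using \<gamma>[of k] by (simp add: field_simps)
    finally show "\<beta> $ k * (\<sigma> k)\<^sup>2 \<le> \<beta> $ k * (\<gamma> k + 1) / \<gamma> k * quad_form (V k) (h k)
        - \<beta> $ k * (\<Sum>j\<in>UNIV. quad_form (V j) (h k))" .
  qed
  ultimately show ?thesis
    by (simp add: sum_subtractf)
qed

text \<open>Component \<open>k\<close> of the maximum comes from one of the two points; that point's
  \<open>k\<close>-th constraint survives because passing to the maximum only enlarges the form of
  \<open>Cmat\<close>.\<close>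

lemma dual_feasible_max:
  assumes herm: "hermitian B" and \<gamma>: "\<And>k. 0 < \<gamma> k"
    and \<beta>: "\<beta> \<in> dual_feasible B h \<gamma>" and \<beta>': "\<beta>' \<in> dual_feasible B h \<gamma>"
  shows "(\<chi> k. max (\<beta> $ k) (\<beta>' $ k)) \<in> dual_feasible B h \<gamma>" (is "?m \<in> _")
  unfolding dual_feasible_def mem_Collect_eq
proof (intro conjI allI)
  show "0 \<le> ?m"
    using \<beta> by (auto simp: dual_feasible_def less_eq_vec_def le_max_iff_disj)
  fix k
  have le: "\<beta> \<le> ?m" "\<beta>' \<le> ?m" by (auto simp: less_eq_vec_def)
  have "?m $ k * (\<gamma> k + 1) / \<gamma> k * (cmod (cip (h k) x))\<^sup>2 \<le> quad_form (Cmat B h ?m) x" for x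
  proof -
    have "b $ k * (\<gamma> k + 1) / \<gamma> k * (cmod (cip (h k) x))\<^sup>2 \<le> quad_form (Cmat B h ?m) x"
      if "b \<in> dual_feasible B h \<gamma>" "b \<le> ?m" for b
    proof -
      have "b $ k * (\<gamma> k + 1) / \<gamma> k * (cmod (cip (h k) x))\<^sup>2 \<le> quad_form (Cmat B h b) x"
        using that(1) by (simp add: dual_feasible_def pos_semidef_Cmat_minus_outer_iff[OF herm])
      then show ?thesis
        using quad_form_Cmat_mono[OF that(2)] order_trans by blast
    qed
    then show ?thesis
      using \<beta> \<beta>' le by (cases "\<beta> $ k \<le> \<beta>' $ k") (auto simp: max_def)
  qed
  then show "pos_semidef (Cmat B h ?m - (?m $ k * (\<gamma> k + 1) / \<gamma> k) *\<^sub>R outer (h k))"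
    unfolding pos_semidef_Cmat_minus_outer_iff[OF herm] by blast
qed

section \<open>Greatest dual feasible point, convergence and uniqueness\<close>

theorem theorem1:
  fixes B :: "complex^'m^'m"
    and h :: "'k::finite \<Rightarrow> complex^'m"
    and \<gamma> \<sigma> :: "'k \<Rightarrow> real"
    and \<beta>hat :: "real^'k"
  assumes "\<And>k. 0 < \<gamma> k"
    and "\<And>k. 0 < (\<sigma> k)\<^sup>2"
    and "hermitian B"
    and "gdb_feasible h \<gamma> \<sigma> \<noteq> {}"
    and "gdb_value B h \<gamma> \<sigma> > -\<infinity>"
    and "\<beta>hat \<in> F B h \<gamma>"
    and "\<And>k. pos_def (Cmat B h \<beta>hat - (\<beta>hat $ k * (\<gamma> k + 1) / \<gamma> k) *\<^sub>R outer (h k))"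
  shows "\<exists>\<beta>opt. dual_solutions B h \<gamma> \<sigma> = {\<beta>opt} \<and>
    (\<forall>\<beta> :: nat \<Rightarrow> real^'k.
       \<beta> 0 \<in> {\<beta>. \<beta> \<ge> \<beta>hat} \<and> (\<forall>i. \<beta> (Suc i) = interference B h \<gamma> (\<beta> i)) \<longrightarrow>
       \<beta> \<longlonglongrightarrow> \<beta>opt) \<and>
    {\<beta> \<in> {\<beta>. \<beta> \<ge> \<beta>hat}. interference B h \<gamma> \<beta> = \<beta>} = {\<beta>opt}"
proof -
  note \<gamma> = assms(1) and \<sigma> = assms(2) and herm = assms(3)
  let ?I = "interference B h \<gamma>" and ?D = "dual_feasible B h \<gamma>"
  obtain V where V: "V \<in> gdb_feasible h \<gamma> \<sigma>"
    using assms(4) by blast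
  \<comment> \<open>For a zero channel the \<open>k\<close>-th downlink constraint would read
    \<open>0 \<ge> (\<sigma> k)\<^sup>2\<close>, contradicting feasibility.\<close>
  have h: "h k \<noteq> 0" for k
  proof
    assume "h k = 0"
    then show False
      using V \<sigma>[of k] by (auto simp: gdb_feasible_def dest: spec[of _ k])
  qed
  have hat0: "0 \<le> \<beta>hat"
    using assms(6) by (simp add: F_def F1_def)
  \<comment> \<open>Adding back the nonnegative rank-one term of any single index to its Slater
    matrix preserves definiteness.\<close>
  have pd_hat: "pos_def (Cmat B h \<beta>hat)"
    unfolding pos_def_def
  proof (intro conjI allI impI hermitian_Cmat herm)
    fix x :: "complex^'m" and k :: 'k
    assume "x \<noteq> 0"
    then have "0 < quad_form (Cmat B h \<beta>hat - (\<beta>hat $ k * (\<gamma> k + 1) / \<gamma> k) *\<^sub>R outer (h k)) x"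
      using assms(7) by (simp add: pos_def_def)
    moreover have "0 \<le> \<beta>hat $ k * (\<gamma> k + 1) / \<gamma> k * (cmod (cip (h k) x))\<^sup>2"
      using hat0 \<gamma>[of k] by (simp add: less_eq_vec_def)
    ultimately show "0 < quad_form (Cmat B h \<beta>hat) x"
      by (simp add: quad_form_diff quad_form_scaleR quad_form_outer)
  qed
  have hat_less: "\<beta>hat $ k < ?I \<beta>hat $ k" for k
  proof -
    have "0 < quad_form (ginverse (Cmat B h \<beta>hat)) (h k)"
      by (rule quad_form_ginverse_pos[OF pd_hat h])
    then have "0 < (\<gamma> k + 1) / \<gamma> k * quad_form (ginverse (Cmat B h \<beta>hat)) (h k)"
      using \<gamma>[of k] by simp
    then show ?thesis
      using pos_def_minus_outer_imp_less[OF pd_hat h assms(7), of k]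
      unfolding interference_nth by (subst pos_less_divide_eq) (simp_all add: mult.assoc)
  qed
  have D_iff: "\<beta> \<in> ?D \<longleftrightarrow> \<beta> \<le> ?I \<beta>" if "\<beta>hat \<le> \<beta>" for \<beta>
  proof -
    have "0 \<le> \<beta>" using hat0 that by (rule order_trans)
    then show ?thesis
      using le_interference_iff[of B \<gamma> _ h \<beta>, OF herm \<gamma> h pos_def_Cmat_mono[OF pd_hat that herm]]
      unfolding dual_feasible_def less_eq_vec_def[of \<beta>]
      by (simp only: mem_Collect_eq pos_semidef_Cmat_minus_outer_iff[OF herm] simp_thms)
  qed
  note mono = interference_mono_on[of B \<gamma> h \<beta>hat, OF herm \<gamma> h pd_hat]
  \<comment> \<open>All summands of the dual objective are nonnegative, so each is at most the
    total, which weak duality bounds by the objective at \<open>V\<close>.\<close>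
  have bounded: "\<beta> $ k \<le> gdb_objective B V / (\<sigma> k)\<^sup>2" if "\<beta> \<in> ?D" for \<beta> k
  proof -
    have "\<beta> $ k * (\<sigma> k)\<^sup>2 \<le> dual_objective \<sigma> \<beta>"
      unfolding dual_objective_def using that
      by (intro member_le_sum) (auto simp: dual_feasible_def less_eq_vec_def)
    also have "\<dots> \<le> gdb_objective B V"
      using gdb_weak_duality[OF V that \<gamma>] .
    finally show ?thesis using \<sigma>[of k] by (simp add: field_simps)
  qed
  have hat_le: "\<beta>hat \<le> ?I \<beta>hat"
    using hat_less by (simp add: less_eq_vec_def less_imp_le)
  obtain p where p: "\<beta>hat \<le> p" "?I p = p"
    and p_greatest: "\<And>x. \<beta>hat \<le> x \<Longrightarrow> x \<le> ?I x \<Longrightarrow> x \<le> p"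
    using mono_greatest_postfixed_point[OF mono hat_le, of "\<lambda>k. gdb_objective B V / (\<sigma> k)\<^sup>2"]
      bounded D_iff by blast
  have conv: "x \<longlonglongrightarrow> p" if "\<beta>hat \<le> x 0" "\<And>n. x (Suc n) = ?I (x n)" for x
    using concave_mono_iteration_tendsto[OF mono _ hat_less p that]
      interference_concave_on[of B \<gamma> _ h, OF herm \<gamma> h pd_hat] by blast
  have pD: "p \<in> ?D" using D_iff p by simp
  \<comment> \<open>A dual feasible \<open>\<beta>\<close> need not dominate
    \<open>\<beta>hat\<close>, but its maximum with \<open>\<beta>hat\<close> does and is still dual
    feasible.\<close>
  have D_le: "\<beta> \<le> p" if "\<beta> \<in> ?D" for \<beta>
  proof -
    define m where "m = (\<chi> k. max (\<beta> $ k) (\<beta>hat $ k))"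
    have "m \<in> ?D"
      unfolding m_def using D_iff[of \<beta>hat] hat_le
      by (intro dual_feasible_max[OF herm \<gamma> that]) simp
    moreover have le: "\<beta>hat \<le> m" "\<beta> \<le> m" by (auto simp: m_def less_eq_vec_def)
    ultimately have "m \<le> p" using p_greatest D_iff by blast
    with le show ?thesis by (rule_tac order_trans)
  qed
  \<comment> \<open>Since \<open>p\<close> dominates every dual feasible point and all weights are
    positive, any other point has a strictly smaller objective.\<close>
  have obj_less: "dual_objective \<sigma> \<beta> < dual_objective \<sigma> p" if \<beta>: "\<beta> \<in> ?D" "\<beta> \<noteq> p" for \<beta>
  proof -
    have le: "\<beta> $ k \<le> p $ k" for k
      using D_le[OF \<beta>(1)] by (simp add: less_eq_vec_def)
    obtain k where "\<beta> $ k \<noteq> p $ k"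
      using \<beta>(2) by (auto simp: vec_eq_iff)
    then have "\<beta> $ k < p $ k" using le[of k] by simp
    then show ?thesis
      unfolding dual_objective_def using le \<sigma>
      by (intro sum_strict_mono_ex1) (auto intro!: mult_right_mono bexI[of _ k])
  qed
  have "dual_solutions B h \<gamma> \<sigma> = {p}"
  proof -
    have "dual_objective \<sigma> \<beta> \<le> dual_objective \<sigma> p" if "\<beta> \<in> ?D" for \<beta>
      using obj_less[OF that] by (cases "\<beta> = p") auto
    moreover have "\<beta> = p" if "\<beta> \<in> dual_solutions B h \<gamma> \<sigma>" for \<beta>
      using obj_less[of \<beta>] that pD by (force simp: dual_solutions_def not_le[symmetric])
    ultimately show ?thesis
      using pD by (auto simp: dual_solutions_def)
  qed
  \<comment> \<open>A fixed point generates a constant iteration, which must also converge to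
    \<open>p\<close>.\<close>
  moreover have "\<beta> = p" if "\<beta>hat \<le> \<beta>" "?I \<beta> = \<beta>" for \<beta>
  proof -
    have "(\<lambda>_::nat. \<beta>) \<longlonglongrightarrow> p"
      by (rule conv) (simp_all add: that)
    then show ?thesis by (simp add: LIMSEQ_const_iff)
  qed
  then have "{\<beta> \<in> {\<beta>. \<beta> \<ge> \<beta>hat}. ?I \<beta> = \<beta>} = {p}"
    using p by blast
  moreover have "\<forall>x. x 0 \<in> {\<beta>. \<beta> \<ge> \<beta>hat} \<and> (\<forall>i. x (Suc i) = ?I (x i)) \<longrightarrow> x \<longlonglongrightarrow> p"
    using conv by blast
  ultimately show ?thesis
    by blast
qed

end
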